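(* Let $\alpha_k$ be defined by $\alpha_k=q^{6r^2-r}$ if $k=3r-1$, $\alpha_k=q^{6r^2+r}$ if $k=3r$, $\alpha_k=-q^{6r^2+5r+1}-q^{6r^2+7r+2}$ if $k=3r+1$. Then for every integer $p\ge1$, every positive integer $N$ and every primitive $N$th root of unity $q$, $$H_p^{(6)}(q)=\sum_{k=0}^{N-1}(-1)^kq^{\binom{k+1}{2}+(p-1)(k^2+k)}\alpha_k.$$
   Context: $(a)_n=\prod_{k=1}^n(1-aq^{k-1})$, $\begin{bmatrix} n\\ k\end{bmatrix}=\frac{(q)_n}{(q)_{n-k}(q)_k}$. $H_p^{(6)}(q)=\sum_{n_p\ge\cdots\ge n_1\ge0}q^{-n_p^2}(q^{n_p+1})_{n_p}\prod_{i=1}^{p-1}q^{n_i^2+n_i}\begin{bmatrix} n_{i+1}\\ n_i\end{bmatrix}$; at a root of unity only finitely many terms are nonzero. *)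

theory Defs
  imports "HOL-Analysis.Analysis"
begin

definition primitive_unity_root :: "nat \<Rightarrow> complex \<Rightarrow> bool" where
  "primitive_unity_root N q \<longleftrightarrow> N > 0 \<and> q ^ N = 1 \<and> (\<forall>m. 0 < m \<and> m < N \<longrightarrow> q ^ m \<noteq> 1)"

definition qpoch :: "complex \<Rightarrow> complex \<Rightarrow> nat \<Rightarrow> complex" where
  "qpoch a q n = (\<Prod>k=1..n. 1 - a * q ^ (k - 1))"

text \<open>
  The Gaussian binomial coefficient as a quotient, for \<open>k \<le> n\<close>. At a primitive \<open>N\<close>-th root of
  unity the denominator vanishes only if \<open>n \<ge> N\<close>; in the sum \<open>H6\<close> below, such coefficients occur
  only in terms with \<open>n\<^sub>p \<ge> N\<close>, where they are multiplied by
  \<open>(q\<^bsup>n\<^sub>p + 1\<^esup>)\<^bsub>n\<^sub>p\<^esub> = 0\<close>.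
\<close>
definition qbinom :: "complex \<Rightarrow> nat \<Rightarrow> nat \<Rightarrow> complex" where
  "qbinom q n k = qpoch q q n / (qpoch q q (n - k) * qpoch q q k)"

text \<open>Tuples \<open>(n\<^sub>1, \<dots>, n\<^sub>p)\<close> with \<open>n\<^sub>p \<ge> \<dots> \<ge> n\<^sub>1 \<ge> 0\<close>, as extensional functions on \<open>{1..p}\<close>.\<close>
definition H6_index :: "nat \<Rightarrow> (nat \<Rightarrow> nat) set" where
  "H6_index p = {n \<in> {1..p} \<rightarrow>\<^sub>E UNIV. \<forall>i\<in>{1..<p}. n i \<le> n (i + 1)}"

definition H6_term :: "nat \<Rightarrow> complex \<Rightarrow> (nat \<Rightarrow> nat) \<Rightarrow> complex" where
  "H6_term p q n =
     q powi (- (int (n p))\<^sup>2) * qpoch (q ^ (n p + 1)) q (n p) *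
     (\<Prod>i=1..p-1. q ^ ((n i)\<^sup>2 + n i) * qbinom q (n (i + 1)) (n i))"

text \<open>
  At a root of unity this is a finite sum, by \<open>finite_H6_support\<close> below.
\<close>
definition H6 :: "nat \<Rightarrow> complex \<Rightarrow> complex" where
  "H6 p q = (\<Sum>\<^sub>\<infinity>n\<in>H6_index p. H6_term p q n)"

text \<open>
  The exponents are natural numbers and no subtraction truncates: \<open>6r\<^sup>2 \<ge> r\<close>. The lemma
  \<open>alpha6_eqs\<close> restates the definition in terms of \<open>k = 3r - 1, 3r, 3r + 1\<close>.
\<close>
definition alpha6 :: "complex \<Rightarrow> nat \<Rightarrow> complex" where
  "alpha6 q k =
     (if k mod 3 = 2 then let r = (k + 1) div 3 in q ^ (6 * r\<^sup>2 - r)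
      else if k mod 3 = 0 then let r = k div 3 in q ^ (6 * r\<^sup>2 + r)
      else let r = (k - 1) div 3 in - (q ^ (6 * r\<^sup>2 + 5 * r + 1)) - q ^ (6 * r\<^sup>2 + 7 * r + 2))"

lemma alpha6_eqs:
  "r \<ge> 1 \<Longrightarrow> alpha6 q (3 * r - 1) = q ^ (6 * r\<^sup>2 - r)"
  "alpha6 q (3 * r) = q ^ (6 * r\<^sup>2 + r)"
  "alpha6 q (3 * r + 1) = - (q ^ (6 * r\<^sup>2 + 5 * r + 1)) - q ^ (6 * r\<^sup>2 + 7 * r + 2)"
proof -
  assume "r \<ge> 1"
  then obtain s where s: "r = Suc s" by (cases r) auto
  have "3 * r - 1 = 3 * s + 2" using s by simp
  then have "(3 * r - 1) mod 3 = 2" "(3 * r - 1 + 1) div 3 = r"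
    using s by presburger+
  then show "alpha6 q (3 * r - 1) = q ^ (6 * r\<^sup>2 - r)"
    unfolding alpha6_def Let_def by (simp only: if_True simp_thms)
qed (simp_all add: alpha6_def Let_def)

lemma qpoch_shift_eq_0:
  assumes "primitive_unity_root N q" "m \<ge> N"
  shows "qpoch (q ^ (m + 1)) q m = 0"
proof -
  from assms have N: "N > 0" "q ^ N = 1" by (auto simp: primitive_unity_root_def)
  define j where "j = N - m mod N"
  have "m mod N < N" using N by simp
  then have j: "j \<ge> 1" "j \<le> m" using assms(2) unfolding j_def by linarith+
  have "m + j = N * (m div N + 1)"
    using \<open>m mod N < N\<close> mult_div_mod_eq[of N m]
    unfolding j_def distrib_left mult_1_right by linarith
  then have "q ^ (m + j) = 1" using N by (simp only: power_mult power_one)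
  moreover have "m + 1 + (j - 1) = m + j" using j by simp
  ultimately have "q ^ (m + 1) * q ^ (j - 1) = 1" by (simp only: power_add [symmetric])
  then have "1 - q ^ (m + 1) * q ^ (j - 1) = 0" by simp
  then show ?thesis unfolding qpoch_def using j
    by (intro prod_zero) (auto intro!: bexI[of _ j])
qed

lemma finite_H6_support:
  assumes "primitive_unity_root N q" "p \<ge> 1"
  shows "finite {n \<in> H6_index p. H6_term p q n \<noteq> 0}"
proof (rule finite_subset)
  show "{n \<in> H6_index p. H6_term p q n \<noteq> 0} \<subseteq> {1..p} \<rightarrow>\<^sub>E {..<N}"
  proof
    fix n assume n: "n \<in> {n \<in> H6_index p. H6_term p q n \<noteq> 0}"
    have "n p < N"
    proof (rule ccontr)
      assume "\<not> n p < N"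
      then have "qpoch (q ^ (n p + 1)) q (n p) = 0"
        using qpoch_shift_eq_0[OF assms(1)] by simp
      then show False using n by (simp add: H6_term_def)
    qed
    moreover have "n i \<le> n p" if "i \<in> {1..p}" for i
    proof -
      from that have "i \<le> p" "1 \<le> i" by auto
      then show ?thesis
      proof (induction rule: inc_induct)
        case (step k)
        then have "n k \<le> n (k + 1)" using n by (auto simp: H6_index_def)
        with step show ?case by simp
      qed simp
    qed
    ultimately show "n \<in> {1..p} \<rightarrow>\<^sub>E {..<N}"
      using n by (force simp: H6_index_def PiE_def Pi_def)
  qed
qed (auto intro: finite_PiE)

end

(*
  Let R(j) = 1/(q)_j for j >= 0 and R(j) = 0 for j < 0.  At a primitive N-th root of unity the
  vectors v_k(n) = q^(n^2+n) R(k-n) R(N-1-k-n), 0 <= k < N, are left eigenvectors, with eigenvalue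
  q^(k^2+k), of the matrix q^(l^2+l) R(n-l) by which the multisum is iterated; this is
  q-Vandermonde, and in essence the Bailey lemma after the reflection n -> N-1-n.  The outer factor
  q^(-n^2) (q)_(2n) of the multisum is (q)_(N-1) times the combination of the v_k with coefficients
  alpha_k.  That is Slater's Bailey pair beta_n = 1/(q^2)_(2n), transported to the root of unity
  by the q-Lucas theorem applied to the polynomial identity
  sum_k alpha_k [2m+1 choose m-k] = 1.
*)
theory Submission
  imports Defs
begin

section \<open>Gaussian binomial coefficients with integer lower index\<close>

text \<open>Pascal's recursion involves no quotient, so the coefficients make sense at a root of
  unity even when q-factorials vanish.\<close>

fun gbinom :: "complex \<Rightarrow> nat \<Rightarrow> int \<Rightarrow> complex" where
  "gbinom q 0 k = (if k = 0 then 1 else 0)"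
| "gbinom q (Suc n) k = gbinom q n k + q powi (int n + 1 - k) * gbinom q n (k - 1)"

lemma gbinom_eq_0: "k < 0 \<or> k > int n \<Longrightarrow> gbinom q n k = 0"
  by (induction n arbitrary: k) auto

lemma gbinom_0_right [simp]: "gbinom q n 0 = 1"
  by (induction n) (auto simp: gbinom_eq_0)

lemma gbinom_self [simp]: "gbinom q n (int n) = 1"
  by (induction n) (auto simp: gbinom_eq_0)

text \<open>The two Pascal rules commute: in either order the cross term carries the exponent
  \<open>(n + 2 - k) + (k - 1) = k + (n + 1 - k)\<close>.\<close>

lemma gbinom_Suc':
  assumes "q \<noteq> 0"
  shows "gbinom q (Suc n) k = gbinom q n (k - 1) + q powi k * gbinom q n k"
proof (induction n arbitrary: k)
  case 0
  then show ?case by auto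
next
  case (Suc n)
  have e: "q powi (int n + 2 - k) * q powi (k - 1) = q powi (int n + 1)"
       "q powi k * q powi (int n + 1 - k) = q powi (int n + 1)"
    using assms by (simp_all flip: power_int_add)
  have "gbinom q (Suc (Suc n)) k
      = gbinom q (Suc n) k + q powi (int n + 2 - k) * gbinom q (Suc n) (k - 1)"
    by (subst gbinom.simps(2)) (simp add: algebra_simps)
  also have "\<dots> = gbinom q n (k - 1) + q powi k * gbinom q n k
      + q powi (int n + 2 - k) * gbinom q n (k - 2)
      + (q powi (int n + 2 - k) * q powi (k - 1)) * gbinom q n (k - 1)"
    unfolding Suc.IH by (simp add: algebra_simps)
  also have "\<dots> = (gbinom q n (k - 1) + q powi (int n + 2 - k) * gbinom q n (k - 2))
      + q powi k * (gbinom q n k + q powi (int n + 1 - k) * gbinom q n (k - 1))"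
    unfolding e(1) e(2) [symmetric] by (simp add: algebra_simps)
  also have "\<dots> = gbinom q (Suc n) (k - 1) + q powi k * gbinom q (Suc n) k"
    by (simp add: algebra_simps)
  finally show ?case .
qed

text \<open>Reflecting the lower index interchanges the two Pascal rules.\<close>

lemma gbinom_symmetric:
  assumes "q \<noteq> 0"
  shows "gbinom q n (int n - k) = gbinom q n k"
proof (induction n arbitrary: k)
  case (Suc n)
  have "gbinom q (Suc n) (int (Suc n) - k)
      = gbinom q n (int n - (k - 1)) + q powi k * gbinom q n (int n - k)"
    by (simp add: algebra_simps)
  also have "\<dots> = gbinom q (Suc n) k"
    unfolding Suc.IH gbinom_Suc'[OF assms] ..
  finally show ?case .
qed auto

lemma qpoch_0 [simp]: "qpoch a q 0 = 1"
  by (simp add: qpoch_def)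

lemma qpoch_Suc: "qpoch a q (Suc n) = qpoch a q n * (1 - a * q ^ n)"
  by (simp add: qpoch_def)

lemma qpoch_add: "qpoch a q (m + n) = qpoch a q m * qpoch (a * q ^ m) q n"
  by (induction n) (simp_all add: qpoch_Suc power_add mult.assoc)

text \<open>The product form stays valid when q-factorials vanish; at \<open>n = N\<close> this is
  what forces the inner coefficients to be zero.\<close>

lemma gbinom_mult_qpoch:
  assumes "k \<le> n"
  shows "gbinom q n (int k) * qpoch q q k * qpoch q q (n - k) = qpoch q q n"
  using assms
proof (induction n arbitrary: k)
  case 0
  then show ?case by simp
next
  case (Suc n)
  consider "k = 0" | "k = Suc n" | j where "k = Suc j" "j < n"
    using Suc.prems by (cases k) (auto simp: le_less)
  then show ?case
  proof cases
    case 2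
    then show ?thesis using gbinom_self[of q "Suc n"] by (simp del: gbinom.simps)
  next
    case 3
    define b where "b = n - Suc j"
    have n: "n = Suc j + b" using 3 by (simp add: b_def)
    have d: "Suc n - k = Suc b" "n - j = Suc b" "n - k = b" "int n + 1 - int k = int (Suc b)"
      using 3 n by auto
    have ih1: "gbinom q n (int k) * qpoch q q k * qpoch q q b = qpoch q q n"
      using Suc.IH[of k] 3 d by simp
    have ih2: "gbinom q n (int j) * qpoch q q j * qpoch q q (Suc b) = qpoch q q n"
      using Suc.IH[of j] 3 d by simp
    have r: "gbinom q (Suc n) (int k) = gbinom q n (int k) + q ^ Suc b * gbinom q n (int j)"
      unfolding gbinom.simps d(4) power_int_of_nat using 3 by simp
    have p: "qpoch q q k = qpoch q q j * (1 - q ^ Suc j)"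
      "qpoch q q (Suc b) = qpoch q q b * (1 - q ^ Suc b)"
      "qpoch q q (Suc n) = qpoch q q n * (1 - q ^ Suc j * q ^ Suc b)"
      using 3(1) n by (simp_all add: qpoch_Suc power_add)
    \<comment> \<open>The two parts recombine by \<open>1 - x * y = (1 - y) + y * (1 - x)\<close>
      with \<open>x = q ^ Suc j\<close> and \<open>y = q ^ Suc b\<close>.\<close>
    have "gbinom q (Suc n) (int k) * qpoch q q k * qpoch q q (Suc n - k)
      = (gbinom q n (int k) * qpoch q q k * qpoch q q b) * (1 - q ^ Suc b)
        + q ^ Suc b * (1 - q ^ Suc j) * (gbinom q n (int j) * qpoch q q j * qpoch q q (Suc b))"
      unfolding r d(1) p(1,2) by (simp only: algebra_simps)
    also have "\<dots> = qpoch q q (Suc n)"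
      unfolding ih1 ih2 p(3) by (simp only: algebra_simps mult_1)
    finally show ?thesis .
  qed simp
qed

section \<open>A polynomial form of Slater's Bailey pair\<close>

text \<open>
  The sequence \<open>\<alpha>\<close> unfolded to the integers: \<open>\<alpha>\<^sub>k\<close> collects the two terms
  at \<open>k\<close> and \<open>-1 - k\<close>, which multiply the same Gaussian binomial coefficient.
\<close>
definition alpha6_int :: "complex \<Rightarrow> int \<Rightarrow> complex" where
  "alpha6_int q i =
     (if i mod 3 = 0 then q powi ((i div 3) * (6 * (i div 3) + 1))
      else if i mod 3 = 1 then - (q powi ((2 * (i div 3) + 1) * (3 * (i div 3) + 1)))
      else 0)"

lemma alpha6_int_eqs:
  "alpha6_int q (3 * j) = q powi (j * (6 * j + 1))"
  "alpha6_int q (3 * j + 1) = - (q powi ((2 * j + 1) * (3 * j + 1)))"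
  "alpha6_int q (3 * j + 2) = 0"
proof -
  have "(3 * j + 1) mod 3 = 1" "(3 * j + 1) div 3 = j" "(3 * j + 2) mod 3 = 2" by presburger+
  then show "alpha6_int q (3 * j) = q powi (j * (6 * j + 1))"
    "alpha6_int q (3 * j + 1) = - (q powi ((2 * j + 1) * (3 * j + 1)))"
    "alpha6_int q (3 * j + 2) = 0"
    by (simp_all add: alpha6_int_def)
qed

lemma int_mod_3_cases:
  fixes i :: int
  obtains j where "i = 3 * j" | j where "i = 3 * j + 1" | j where "i = 3 * j + 2"
proof -
  have "i = 3 * (i div 3) \<or> i = 3 * (i div 3) + 1 \<or> i = 3 * (i div 3) + 2" by presburger
  then show ?thesis using that by blast
qed

text \<open>For \<open>k = 3r\<close> only the index \<open>k\<close> contributes, for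
  \<open>k = 3r + 1\<close> both do, and for \<open>k = 3s + 2\<close> only
  \<open>-1 - k = -3(s + 1)\<close> does.\<close>

lemma alpha6_eq_alpha6_int: "alpha6 q k = alpha6_int q (int k) + alpha6_int q (- 1 - int k)"
proof -
  consider r where "k = 3 * r" | r where "k = 3 * r + 1" | s where "k = 3 * s + 2"
  proof -
    have "k = 3 * (k div 3) \<or> k = 3 * (k div 3) + 1 \<or> k = 3 * (k div 3) + 2" by presburger
    then show ?thesis using that by blast
  qed
  then show ?thesis
  proof cases
    case 1
    have a: "int k = 3 * int r" "- 1 - int k = 3 * (- int r - 1) + 2" using 1 by auto
    have e: "int r * (6 * int r + 1) = int (6 * r\<^sup>2 + r)"
      by (simp add: power2_eq_square algebra_simps)
    show ?thesis
      unfolding a(2) unfolding a(1) alpha6_int_eqs e power_int_of_nat unfolding 1 alpha6_eqs by simp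
  next
    case 2
    have a: "int k = 3 * int r + 1" "- 1 - int k = 3 * (- int r - 1) + 1" using 2 by auto
    have e: "(2 * int r + 1) * (3 * int r + 1) = int (6 * r\<^sup>2 + 5 * r + 1)"
      "(2 * (- int r - 1) + 1) * (3 * (- int r - 1) + 1) = int (6 * r\<^sup>2 + 7 * r + 2)"
      by (simp_all add: power2_eq_square algebra_simps)
    show ?thesis
      unfolding a(2) unfolding a(1) alpha6_int_eqs e power_int_of_nat unfolding 2 alpha6_eqs by simp
  next
    case 3
    have a: "int k = 3 * int s + 2" "- 1 - int k = 3 * (- int (Suc s))" using 3 by auto
    have "6 * (Suc s)\<^sup>2 \<ge> Suc s" by (simp add: power2_eq_square)
    then have e: "- int (Suc s) * (6 * (- int (Suc s)) + 1) = int (6 * (Suc s)\<^sup>2 - Suc s)"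
      by (simp add: of_nat_diff power2_eq_square algebra_simps)
    have k: "k = 3 * Suc s - 1" using 3 by simp
    show ?thesis
      unfolding a(2) unfolding a(1) alpha6_int_eqs e power_int_of_nat unfolding k by (subst alpha6_eqs) auto
  qed
qed

text \<open>The map \<open>i -> -2 - i\<close> swaps the residue classes 0 and 1 mod 3, which carry
  opposite signs, and preserves class 2, where the sequence vanishes; the quadratic exponents then
  match. This serves the step from even to odd upper index.\<close>

lemma alpha6_int_reflect_odd:
  assumes "q \<noteq> 0"
  shows "alpha6_int q (- 2 - i) * q powi (- 1 - i) = - (alpha6_int q i * q powi (1 + i))"
proof (cases i rule: int_mod_3_cases)
  case (1 j)
  have a: "- 2 - i = 3 * (- 1 - j) + 1" using 1 by simp
  show ?thesis
    unfolding a alpha6_int_eqs unfolding 1 alpha6_int_eqs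
    using assms by (simp flip: power_int_add add: algebra_simps)
next
  case (2 j)
  have a: "- 2 - i = 3 * (- 1 - j)" using 2 by simp
  show ?thesis
    unfolding a alpha6_int_eqs unfolding 2 alpha6_int_eqs
    using assms by (simp flip: power_int_add add: algebra_simps)
next
  case (3 j)
  have a: "- 2 - i = 3 * (- 2 - j) + 2" using 3 by simp
  show ?thesis
    unfolding a alpha6_int_eqs unfolding 3 alpha6_int_eqs by simp
qed

text \<open>The same mechanism for \<open>i -> 1 - i\<close>, serving the step from odd to even
  upper index.\<close>

lemma alpha6_int_reflect_even:
  assumes "q \<noteq> 0"
  shows "alpha6_int q (1 - i) * q powi (i - 1) = - (alpha6_int q i * q powi (- i))"
proof (cases i rule: int_mod_3_cases)
  case (1 j)
  have a: "1 - i = 3 * (- j) + 1" using 1 by simp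
  show ?thesis
    unfolding a alpha6_int_eqs unfolding 1 alpha6_int_eqs
    using assms by (simp flip: power_int_add add: algebra_simps)
next
  case (2 j)
  have a: "1 - i = 3 * (- j)" using 2 by simp
  show ?thesis
    unfolding a alpha6_int_eqs unfolding 2 alpha6_int_eqs
    using assms by (simp flip: power_int_add add: algebra_simps)
next
  case (3 j)
  have a: "1 - i = 3 * (- 1 - j) + 2" using 3 by simp
  show ?thesis
    unfolding a alpha6_int_eqs unfolding 3 alpha6_int_eqs by simp
qed

text \<open>\<open>I\<close> need not be stable under the involution, but the support of
  \<open>f\<close> is; over it the sum equals its own negative.\<close>

lemma sum_antisymmetric_eq_0:
  fixes f :: "'a \<Rightarrow> complex"
  assumes I: "finite I" "\<And>i. i \<notin> I \<Longrightarrow> f i = 0"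
    and \<sigma>: "\<And>i. \<sigma> (\<sigma> i) = i" "\<And>i. f (\<sigma> i) = - f i"
  shows "sum f I = 0"
proof -
  let ?Z = "{i. f i \<noteq> 0}"
  have "sum f I = sum f ?Z"
    using I by (intro sum.mono_neutral_right) auto
  also have "sum f ?Z = (\<Sum>i\<in>?Z. - f i)"
    by (rule sum.reindex_bij_witness[of _ \<sigma> \<sigma>]) (auto simp: \<sigma>)
  also have "\<dots> = - sum f ?Z"
    by (rule sum_negf)
  also have "sum f ?Z = sum f I"
    using I by (intro sum.mono_neutral_left) auto
  finally have "2 * sum f I = 0"
    by (metis eq_neg_iff_add_eq_0 mult_2)
  then show ?thesis by simp
qed

text \<open>
  Passing from \<open>L\<close> to \<open>L + 1\<close> by Pascal's rule leaves a remainder that is antisymmetric under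
  a reflection of \<open>i\<close>.
\<close>
lemma sum_alpha6_int_gbinom:
  assumes "q \<noteq> 0" "finite I" "{- int L..int L} \<subseteq> I"
  shows "(\<Sum>i\<in>I. alpha6_int q i * gbinom q L (int (L div 2) - i)) = 1"
  using assms(2,3)
proof (induction L)
  case 0
  have "(\<Sum>i\<in>I. alpha6_int q i * gbinom q 0 (int (0 div 2) - i))
      = (\<Sum>i\<in>I. if i = 0 then 1 else 0)"
    by (rule sum.cong) (auto simp: alpha6_int_def)
  also have "\<dots> = 1" using 0 by simp
  finally show ?case .
next
  case (Suc L)
  from Suc have IH: "(\<Sum>i\<in>I. alpha6_int q i * gbinom q L (int (L div 2) - i)) = 1"
    by (auto simp: subset_iff)
  have out: "i < - int (Suc L) \<or> i > int (Suc L)" if "i \<notin> I" for i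
    using that Suc.prems(2) by (meson atLeastAtMost_iff linorder_not_less subsetD)
  show ?case
  proof (cases "even L")
    case True
    then obtain m where L: "L = 2 * m" by blast
    \<comment> \<open>Here \<open>L div 2\<close> does not change, so the defining Pascal rule keeps
      the lower index \<open>m - i\<close>, and \<open>f\<close> is its second summand.\<close>
    define f where
      "f i = alpha6_int q i * q powi (int m + 1 + i) * gbinom q L (int m - i - 1)" for i
    have "sum f I = 0"
    proof (rule sum_antisymmetric_eq_0[where \<sigma> = "\<lambda>i. - 2 - i"])
      fix i assume "i \<notin> I"
      from out[OF this] show "f i = 0" by (auto simp: f_def L intro!: gbinom_eq_0)
    next
      fix i
      have "int m - (- 2 - i) - 1 = int L - (int m - i - 1)" by (simp add: L)
      then have g: "gbinom q L (int m - (- 2 - i) - 1) = gbinom q L (int m - i - 1)"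
        using gbinom_symmetric[OF assms(1)] by metis
      have e: "q powi (int m + 1 + (- 2 - i)) = q powi int m * q powi (- 1 - i)"
        "q powi (int m + 1 + i) = q powi int m * q powi (1 + i)"
        using assms(1) by (simp_all del: power_int_of_nat flip: power_int_add add: algebra_simps)
      have "f (- 2 - i)
          = (alpha6_int q (- 2 - i) * q powi (- 1 - i)) * q powi int m * gbinom q L (int m - i - 1)"
        unfolding f_def g e by (simp only: mult_ac)
      also have "\<dots> = - f i"
        unfolding alpha6_int_reflect_odd[OF assms(1)] f_def e by (simp add: mult_ac)
      finally show "f (- 2 - i) = - f i" .
    qed (use Suc.prems in auto)
    moreover have "alpha6_int q i * gbinom q (Suc L) (int (Suc L div 2) - i)
        = alpha6_int q i * gbinom q L (int (L div 2) - i) + f i" for i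
      by (simp add: L f_def algebra_simps)
    ultimately show ?thesis
      using IH by (simp add: sum.distrib del: gbinom.simps)
  next
    case False
    then obtain m where L: "L = 2 * m + 1" by (blast elim: oddE)
    \<comment> \<open>Here \<open>L div 2\<close> grows by one, so the other Pascal rule is the one
      that leaves the old lower index \<open>m - i\<close> in the main term.\<close>
    define f where
      "f i = alpha6_int q i * q powi (int m + 1 - i) * gbinom q L (int m + 1 - i)" for i
    have "sum f I = 0"
    proof (rule sum_antisymmetric_eq_0[where \<sigma> = "\<lambda>i. 1 - i"])
      fix i assume "i \<notin> I"
      from out[OF this] show "f i = 0"
        unfolding f_def L by (subst gbinom_eq_0) auto
    next
      fix i
      have "int m + 1 - (1 - i) = int L - (int m + 1 - i)" by (simp add: L)
      then have g: "gbinom q L (int m + 1 - (1 - i)) = gbinom q L (int m + 1 - i)"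
        using gbinom_symmetric[OF assms(1)] by metis
      have e: "q powi (int m + 1 - (1 - i)) = q powi (int m + 1) * q powi (i - 1)"
        "q powi (int m + 1 - i) = q powi (int m + 1) * q powi (- i)"
        using assms(1) by (simp_all del: power_int_of_nat flip: power_int_add add: algebra_simps)
      have "f (1 - i) = (alpha6_int q (1 - i) * q powi (i - 1)) * q powi (int m + 1)
          * gbinom q L (int m + 1 - i)"
        unfolding f_def g e by (simp only: mult_ac)
      also have "\<dots> = - f i"
        unfolding alpha6_int_reflect_even[OF assms(1)] f_def e by (simp add: mult_ac)
      finally show "f (1 - i) = - f i" .
    qed (use Suc.prems in auto)
    moreover have "alpha6_int q i * gbinom q (Suc L) (int (Suc L div 2) - i)
        = alpha6_int q i * gbinom q L (int (L div 2) - i) + f i" for i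
    proof -
      have "int (Suc L div 2) - i = int m + 1 - i" "int (L div 2) - i = int m + 1 - i - 1"
        by (simp_all add: L)
      then show ?thesis
        unfolding f_def gbinom_Suc'[OF assms(1)] by (simp add: algebra_simps)
    qed
    ultimately show ?thesis
      using IH by (simp add: sum.distrib del: gbinom.simps)
  qed
qed

text \<open>The sum over all integers is folded at -1/2: \<open>i\<close> and \<open>-1 - i\<close>
  have the same coefficient because the upper index is odd. The support is contained in
  \<open>-m - 1 .. m\<close>, so \<open>m < M\<close> loses no term.\<close>

lemma sum_alpha6_gbinom:
  assumes "q \<noteq> 0" "m < M"
  shows "(\<Sum>k<M. alpha6 q k * gbinom q (2 * m + 1) (int m - int k)) = 1"
proof -
  define f where "f i = alpha6_int q i * gbinom q (2 * m + 1) (int m - i)" for i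
  have "alpha6 q k * gbinom q (2 * m + 1) (int m - int k) = f (int k) + f (- 1 - int k)" for k
  proof -
    have "int m - (- 1 - int k) = int (2 * m + 1) - (int m - int k)" by simp
    then have "gbinom q (2 * m + 1) (int m - (- 1 - int k))
        = gbinom q (2 * m + 1) (int m - int k)"
      using gbinom_symmetric[OF assms(1)] by metis
    then show ?thesis
      unfolding f_def alpha6_eq_alpha6_int by (simp add: algebra_simps)
  qed
  then have "(\<Sum>k<M. alpha6 q k * gbinom q (2 * m + 1) (int m - int k))
      = (\<Sum>k<M. f (int k)) + (\<Sum>k<M. f (- 1 - int k))"
    by (simp add: sum.distrib)
  also have "(\<Sum>k<M. f (int k)) = sum f {0..<int M}"
    by (rule sum.reindex_bij_witness[of _ nat int]) auto
  also have "(\<Sum>k<M. f (- 1 - int k)) = sum f {- int M..<0}"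
    by (rule sum.reindex_bij_witness[of _ "\<lambda>i. nat (- 1 - i)" "\<lambda>k. - 1 - int k"]) auto
  also have "sum f {0..<int M} + sum f {- int M..<0} = sum f ({0..<int M} \<union> {- int M..<0})"
    by (subst sum.union_disjoint) auto
  \<comment> \<open>Zero terms are added to reach an index set that contains \<open>-L .. L\<close>
    for \<open>L = 2 * m + 1\<close>.\<close>
  also have "\<dots> = sum f ({0..<int M} \<union> {- int M..<0} \<union> {- int (2 * m + 1)..int (2 * m + 1)})"
  proof (intro sum.mono_neutral_left ballI)
    fix i
    assume "i \<in> {0..<int M} \<union> {- int M..<0} \<union> {- int (2 * m + 1)..int (2 * m + 1)}
      - ({0..<int M} \<union> {- int M..<0})"
    then have "int m - i < 0 \<or> int m - i > int (2 * m + 1)"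
      using assms(2) by auto
    then show "f i = 0" unfolding f_def by (simp only: gbinom_eq_0 mult_zero_right)
  qed auto
  also have "\<dots> = 1"
    using sum_alpha6_int_gbinom[OF assms(1), of _ "2 * m + 1"] unfolding f_def
    by (simp del: gbinom.simps)
  finally show ?thesis .
qed

section \<open>Roots of unity\<close>

text \<open>The \<open>R\<close> of the opening outline; its zero branch encodes the natural
  boundaries of the sums.\<close>

definition rqpoch :: "complex \<Rightarrow> int \<Rightarrow> complex" where
  "rqpoch q j = (if j < 0 then 0 else 1 / qpoch q q (nat j))"

lemma rqpoch_neg [simp]: "j < 0 \<Longrightarrow> rqpoch q j = 0"
  by (simp add: rqpoch_def)

lemma rqpoch_of_nat: "rqpoch q (int n) = 1 / qpoch q q n"
  by (simp add: rqpoch_def)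

context
  fixes N :: nat and q :: complex
  assumes prim: "primitive_unity_root N q"
begin

lemma N_pos: "N > 0" and q_pow_N: "q ^ N = 1" and q_nonzero: "q \<noteq> 0"
  and q_pow_neq_1: "0 < m \<Longrightarrow> m < N \<Longrightarrow> q ^ m \<noteq> 1"
  using prim by (auto simp: primitive_unity_root_def power_0_left)

lemma q_pow_eqI: "a = b + N * c \<Longrightarrow> q ^ a = q ^ b"
  by (simp add: power_add power_mult q_pow_N)

lemma qpoch_nonzero: "n < N \<Longrightarrow> qpoch q q n \<noteq> 0"
proof (induction n)
  case (Suc n)
  then show ?case using q_pow_neq_1[of "Suc n"] by (simp add: qpoch_Suc)
qed simp

lemma qpoch_zero:
  assumes "n \<ge> N"
  shows "qpoch q q n = 0"
proof -
  from assms obtain d where n: "n = Suc (N - 1) + d"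
    using N_pos by (metis Suc_diff_1 le_add_diff_inverse)
  have "q * q ^ (N - 1) = 1" using N_pos q_pow_N by (simp flip: power_Suc)
  then show ?thesis unfolding n qpoch_add by (simp add: qpoch_Suc)
qed

text \<open>For \<open>0 < k < N\<close> the coefficient times two nonzero q-factorials equals
  \<open>qpoch q q N = 0\<close>. The bound on \<open>j\<close> excludes \<open>j = N\<close>, where
  the value is 1.\<close>

lemma gbinom_N:
  assumes "j < int N"
  shows "gbinom q N j = (if j = 0 then 1 else 0)"
proof -
  consider "j < 0" | "j = 0" | "j > 0" by linarith
  then show ?thesis
  proof cases
    case 3
    then obtain k where k: "j = int k" "0 < k" "k < N"
      using assms by (metis of_nat_less_iff of_nat_0_less_iff zero_less_imp_eq_int)
    have "gbinom q N (int k) * qpoch q q k * qpoch q q (N - k) = 0"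
      using gbinom_mult_qpoch[of k N q] k qpoch_zero by simp
    then show ?thesis using qpoch_nonzero[of k] qpoch_nonzero[of "N - k"] k by simp
  qed (auto simp: gbinom_eq_0)
qed

text \<open>The \<open>q\<close>-analogue of Lucas' theorem.\<close>
lemma gbinom_N_add:
  assumes "j < int N"
  shows "gbinom q (N + r) j = gbinom q r j"
  using assms
proof (induction r arbitrary: j)
  case 0
  then show ?case using gbinom_N by simp
next
  case (Suc r)
  \<comment> \<open>Pascal's rule never raises \<open>j\<close>, so the bound persists, and the
    extra \<open>N\<close> in the exponent disappears by \<open>q ^ N = 1\<close>.\<close>
  have e: "int (N + r) + 1 - j = int N + (int r + 1 - j)" by simp
  have "q powi (int (N + r) + 1 - j) = q powi (int r + 1 - j)"
    unfolding e power_int_add[OF disjI1[OF q_nonzero]] power_int_of_nat q_pow_N by simp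
  then show ?case using Suc by simp
qed

lemma gbinom_eq_rqpoch:
  assumes "r < N"
  shows "gbinom q r j = qpoch q q r * rqpoch q j * rqpoch q (int r - j)"
proof (cases "j < 0 \<or> j > int r")
  case True
  then show ?thesis by (auto simp: gbinom_eq_0)
next
  case False
  then obtain k where k: "j = int k" "k \<le> r"
    by (metis not_less of_nat_le_iff zero_le_imp_eq_int)
  have d: "int r - j = int (r - k)" using k by simp
  show ?thesis
    unfolding d unfolding k(1) rqpoch_of_nat using gbinom_mult_qpoch[OF k(2), of q] k assms
      qpoch_nonzero[of k] qpoch_nonzero[of "r - k"]
    by (simp add: field_simps)
qed

text \<open>The polynomial identity is taken at \<open>m = N - 1 - n\<close>: its upper index is
  \<open>2 * m + 1 = N + r\<close> with \<open>r = N - 1 - 2 * n\<close>, and q-Lucas removes the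
  \<open>N\<close>.\<close>

lemma sum_alpha6_rqpoch:
  assumes "2 * n < N"
  shows "(\<Sum>k<N. alpha6 q k * (rqpoch q (int k - int n) * rqpoch q (int N - 1 - int k - int n)))
    = 1 / qpoch q q (N - 1 - 2 * n)"
proof -
  define m r where "m = N - 1 - n" and "r = N - 1 - 2 * n"
  have r: "2 * m + 1 = N + r" "r < N" "m < N" using assms by (auto simp: m_def r_def)
  have g: "gbinom q (2 * m + 1) (int m - int k)
      = qpoch q q r * (rqpoch q (int k - int n) * rqpoch q (int N - 1 - int k - int n))" for k
  proof -
    have e: "int r - (int m - int k) = int k - int n" "int m - int k = int N - 1 - int k - int n"
      using assms by (auto simp: m_def r_def)
    have "gbinom q (2 * m + 1) (int m - int k) = gbinom q r (int m - int k)"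
      unfolding r(1) using r(3) by (intro gbinom_N_add) simp
    also have "\<dots> = qpoch q q r * rqpoch q (int m - int k) * rqpoch q (int r - (int m - int k))"
      by (rule gbinom_eq_rqpoch[OF r(2)])
    finally show ?thesis unfolding e(1) unfolding e(2) by (simp only: mult_ac)
  qed
  have "qpoch q q r *
      (\<Sum>k<N. alpha6 q k * (rqpoch q (int k - int n) * rqpoch q (int N - 1 - int k - int n))) = 1"
    using sum_alpha6_gbinom[OF q_nonzero r(3)] unfolding g
    by (simp add: sum_distrib_left mult_ac)
  then show ?thesis
    using qpoch_nonzero[OF r(2)] unfolding r_def by (simp add: field_simps)
qed

text \<open>Since \<open>q ^ N = 1\<close>,
  \<open>q ^ Suc r - 1 = q ^ Suc r * (1 - q ^ (N - 1 - r))\<close>, so a factor moves from one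
  q-factorial to the other at the cost of a sign and \<open>q ^ Suc r\<close>; these powers
  accumulate to the triangular exponent.\<close>

lemma qpoch_reflect:
  assumes "r < N"
  shows "qpoch q q (N - 1 - r) * qpoch q q r * (-1) ^ r = q ^ (Suc r choose 2) * qpoch q q (N - 1)"
  using assms
proof (induction r)
  case 0
  then show ?case by (simp add: binomial_eq_0)
next
  case (Suc r)
  define a where "a = N - 1 - Suc r"
  have a: "N - 1 - r = Suc a" using Suc.prems by (simp add: a_def)
  have "Suc a + Suc r = N" using Suc.prems by (simp add: a_def)
  then have qN: "q ^ Suc a * q ^ Suc r = 1" using q_pow_N by (metis power_add)
  have IH: "qpoch q q (Suc a) * qpoch q q r * (-1) ^ r = q ^ (Suc r choose 2) * qpoch q q (N - 1)"
    using Suc a by simp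
  have c: "Suc (Suc r) choose 2 = (Suc r choose 2) + Suc r"
    by (simp add: numeral_2_eq_2)
  have "qpoch q q a * qpoch q q (Suc r) * (-1) ^ Suc r
      = qpoch q q a * qpoch q q r * (-1) ^ r * (q ^ Suc r - 1)"
    by (simp add: qpoch_Suc algebra_simps)
  also have "q ^ Suc r - 1 = (1 - q ^ Suc a) * q ^ Suc r"
    using qN by (simp add: algebra_simps)
  also have "qpoch q q a * qpoch q q r * (-1) ^ r * ((1 - q ^ Suc a) * q ^ Suc r)
      = (qpoch q q (Suc a) * qpoch q q r * (-1) ^ r) * q ^ Suc r"
    by (simp add: qpoch_Suc mult_ac)
  also have "\<dots> = q ^ (Suc (Suc r) choose 2) * qpoch q q (N - 1)"
    unfolding IH c power_add by (simp only: mult_ac)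
  finally show ?case unfolding a_def .
qed

section \<open>q-Vandermonde and the eigenvector relation\<close>

text \<open>Induction with \<open>c\<close> general:
  \<open>1 - q^(n+1) = (1 - q^(n+1-s)) + q^(n+1-s) * (1 - q^s)\<close> splits the sum into the
  instances \<open>(n, c)\<close> and \<open>(n, c + 1)\<close>. The bound keeps all denominators
  nonzero.\<close>

lemma q_vandermonde:
  assumes "n + c < N"
  shows "(\<Sum>s\<le>n. q ^ (s * (s + c)) / (qpoch q q (n - s) * qpoch q q s * qpoch q q (s + c)))
    = 1 / (qpoch q q n * qpoch q q (n + c))"
  using assms
proof (induction n arbitrary: c)
  case 0
  then show ?case by simp
next
  case (Suc n)
  let ?P = "qpoch q q"
  define f where "f n c s = q ^ (s * (s + c)) / (?P (n - s) * ?P s * ?P (s + c))" for n c s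
  have IH: "sum (f n c) {..n} = 1 / (?P n * ?P (n + c))" if "n + c < N" for c
    unfolding f_def by (rule Suc.IH) (rule that)
  have nz: "1 - q ^ Suc i \<noteq> 0" if "Suc i < N" for i
    using q_pow_neq_1[of "Suc i"] that by simp
  \<comment> \<open>\<open>g\<close> is the part where a factor of \<open>(q)_(n+1-s)\<close>
    cancels; in \<open>h\<close> a factor of \<open>(q)_s\<close> cancels, which shifts
    \<open>s\<close> by one.\<close>
  define g h where
    "g s = (if s \<le> n then f n c s else 0)" and
    "h s = (if s = 0 then 0 else q ^ Suc (n + c) * f n (Suc c) (s - 1))" for s
  have split: "(1 - q ^ Suc n) * f (Suc n) c s = g s + h s" if "s \<le> Suc n" for s
  proof -
    have A: "(1 - q ^ (Suc n - s)) * f (Suc n) c s = g s"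
    proof (cases "s \<le> n")
      case True
      then have "Suc n - s = Suc (n - s)" by simp
      then show ?thesis
        using nz[of "n - s"] True Suc.prems by (simp add: g_def f_def qpoch_Suc)
    next
      case False
      then show ?thesis using that by (simp add: g_def)
    qed
    have B: "q ^ (Suc n - s) * (1 - q ^ s) * f (Suc n) c s = h s"
    proof (cases s)
      case (Suc t)
      have e: "q ^ (Suc n - s) * q ^ (s * (s + c)) = q ^ Suc (n + c) * q ^ (t * (t + Suc c))"
      proof -
        have "t \<le> n" using that Suc by simp
        then obtain d where d: "n = t + d" using le_Suc_ex by blast
        show ?thesis
          unfolding power_add [symmetric] Suc d by (rule arg_cong) (simp add: algebra_simps)
      qed
      have "q ^ (Suc n - s) * (1 - q ^ s) * f (Suc n) c s
          = (q ^ (Suc n - s) * q ^ (s * (s + c))) * ((1 - q ^ Suc t) / ?P (Suc t))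
              / (?P (n - t) * ?P (t + Suc c))"
        unfolding f_def Suc
        by (simp only: times_divide_eq_left times_divide_eq_right divide_divide_eq_left
            diff_Suc_Suc add_Suc add_Suc_right mult_ac)
      also have "(1 - q ^ Suc t) / ?P (Suc t) = 1 / ?P t"
        using nz[of t] Suc that Suc.prems by (simp add: qpoch_Suc)
      finally show ?thesis unfolding e by (simp add: h_def f_def Suc)
    qed (simp add: h_def)
    have "q ^ (Suc n - s) * q ^ s = q ^ Suc n"
      using that by (simp flip: power_add)
    then have "1 - q ^ Suc n = (1 - q ^ (Suc n - s)) + q ^ (Suc n - s) * (1 - q ^ s)"
      by (simp add: algebra_simps)
    then have "(1 - q ^ Suc n) * f (Suc n) c s = (1 - q ^ (Suc n - s)) * f (Suc n) c s
        + q ^ (Suc n - s) * (1 - q ^ s) * f (Suc n) c s"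
      by (simp only: distrib_right)
    then show ?thesis unfolding A B .
  qed
  have "(1 - q ^ Suc n) * sum (f (Suc n) c) {..Suc n} = sum g {..Suc n} + sum h {..Suc n}"
    unfolding sum_distrib_left sum.distrib [symmetric] by (rule sum.cong) (use split in auto)
  also have "sum g {..Suc n} = sum (f n c) {..n}"
    by (simp add: g_def)
  also have "sum h {..Suc n} = q ^ Suc (n + c) * sum (f n (Suc c)) {..n}"
    unfolding sum.atMost_Suc_shift by (simp add: h_def sum_distrib_left)
  also have "sum (f n c) {..n} = 1 / (?P n * ?P (n + c))"
    using Suc.prems by (intro IH) simp
  also have "sum (f n (Suc c)) {..n} = 1 / (?P n * ?P (Suc (n + c)))"
    using Suc.prems IH[of "Suc c"] by simp
  \<comment> \<open>Over the common denominator the numerators are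
    \<open>1 - q ^ Suc (n + c)\<close> and \<open>q ^ Suc (n + c)\<close>.\<close>
  also have "1 / (?P n * ?P (n + c)) + q ^ Suc (n + c) * (1 / (?P n * ?P (Suc (n + c))))
      = 1 / (?P n * ?P (Suc (n + c)))"
    using nz[of "n + c"] Suc.prems qpoch_nonzero[of n] qpoch_nonzero[of "n + c"]
    by (simp add: qpoch_Suc field_simps)
  finally have "sum (f (Suc n) c) {..Suc n} = 1 / (?P n * ?P (Suc (n + c))) / (1 - q ^ Suc n)"
    using nz[of n] Suc.prems by (metis add_lessD1 add_Suc nonzero_mult_div_cancel_left)
  then show ?case by (simp add: f_def qpoch_Suc)
qed

text \<open>
  Both sides are invariant under \<open>k \<mapsto> N - 1 - k\<close>, so that it suffices to treat \<open>2k < N\<close>; then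
  \<open>n = k - s\<close> turns the left-hand side into the sum of \<open>q_vandermonde\<close> with \<open>c = N - 1 - 2k\<close>.
\<close>
lemma bailey_step_aux:
  assumes "2 * k < N"
  shows "(\<Sum>n<N. q ^ (n\<^sup>2 + n) * (rqpoch q (int k - int n) * rqpoch q (int N - 1 - int k - int n))
      * rqpoch q (int n - int l))
    = q ^ (k\<^sup>2 + k) * (rqpoch q (int k - int l) * rqpoch q (int N - 1 - int k - int l))"
proof (cases "l \<le> k")
  case False
  have z: "q ^ (n\<^sup>2 + n) * (rqpoch q (int k - int n) * rqpoch q (int N - 1 - int k - int n))
      * rqpoch q (int n - int l) = 0" for n
    using False by (cases "n \<le> k") auto
  show ?thesis unfolding z using False by simp
next
  case True
  define c where "c = N - 1 - 2 * k"
  let ?P = "qpoch q q"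
  define f where "f n = q ^ (n\<^sup>2 + n)
    * (rqpoch q (int k - int n) * rqpoch q (int N - 1 - int k - int n)) * rqpoch q (int n - int l)"
    for n
  have "sum f {..<N} = sum f {l..k}"
    using assms by (intro sum.mono_neutral_right) (auto simp: f_def)
  also have "\<dots> = (\<Sum>s\<le>k - l. f (k - s))"
    using True by (intro sum.reindex_bij_witness[of _ "\<lambda>s. k - s" "\<lambda>n. k - n"]) auto
  also have "\<dots> = (\<Sum>s\<le>k - l. q ^ (k\<^sup>2 + k) *
      (q ^ (s * (s + c)) / (?P (k - l - s) * ?P s * ?P (s + c))))"
  proof (rule sum.cong)
    fix s assume "s \<in> {..k - l}"
    then have s: "s \<le> k - l" by simp
    obtain t where k: "k = s + t" using s True by (metis le_add_diff_inverse le_trans diff_le_self)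
    have i: "int k - int (k - s) = int s" "int N - 1 - int k - int (k - s) = int (s + c)"
      "int (k - s) - int l = int (k - l - s)"
      using s True assms by (auto simp: c_def of_nat_diff)
    have N: "N = 2 * s + 2 * t + c + 1" using assms k by (simp add: c_def)
    \<comment> \<open>Here \<open>N = 2k + c + 1\<close>, so the linear cross terms form the
      multiple \<open>N * s\<close>, which \<open>q\<close> does not see.\<close>
    have "(k\<^sup>2 + k) + s * (s + c) = ((k - s)\<^sup>2 + (k - s)) + N * s"
      unfolding N k by (simp add: power2_eq_square algebra_simps)
    then have "q ^ ((k - s)\<^sup>2 + (k - s)) = q ^ (k\<^sup>2 + k) * q ^ (s * (s + c))"
      unfolding power_add [symmetric] by (rule q_pow_eqI [symmetric])
    then show "f (k - s) = q ^ (k\<^sup>2 + k) *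
        (q ^ (s * (s + c)) / (?P (k - l - s) * ?P s * ?P (s + c)))"
      unfolding f_def i rqpoch_of_nat by (simp add: mult_ac)
  qed simp
  also have "\<dots> = q ^ (k\<^sup>2 + k) * (1 / (?P (k - l) * ?P (k - l + c)))"
    unfolding sum_distrib_left [symmetric]
    by (subst q_vandermonde) (use assms True in \<open>auto simp: c_def\<close>)
  also have "\<dots> = q ^ (k\<^sup>2 + k) * (rqpoch q (int k - int l) * rqpoch q (int N - 1 - int k - int l))"
  proof -
    have "int k - int l = int (k - l)" "int N - 1 - int k - int l = int (k - l + c)"
      using assms True by (auto simp: c_def of_nat_diff)
    then show ?thesis by (simp only: rqpoch_of_nat) simp
  qed
  finally show ?thesis unfolding f_def .
qed

text \<open>The left-eigenvector relation of the opening outline, with the common factor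
  \<open>q ^ (l^2 + l)\<close> removed from both sides.\<close>

lemma bailey_step:
  assumes "k < N"
  shows "(\<Sum>n<N. q ^ (n\<^sup>2 + n) * (rqpoch q (int k - int n) * rqpoch q (int N - 1 - int k - int n))
      * rqpoch q (int n - int l))
    = q ^ (k\<^sup>2 + k) * (rqpoch q (int k - int l) * rqpoch q (int N - 1 - int k - int l))"
proof (cases "2 * k < N")
  case True
  then show ?thesis by (rule bailey_step_aux)
next
  case False
  define j where "j = N - 1 - k"
  have j: "2 * j < N" using False assms by (simp add: j_def)
  have i: "int k - x = int N - 1 - int j - x" "int N - 1 - int k - x = int j - x" for x
    using assms by (auto simp: j_def)
  have k: "k = j + (N - 1 - 2 * j)" using j assms by (simp add: j_def)
  obtain d where d: "N = 2 * j + 1 + d"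
    using j by (metis Suc_eq_plus1 Suc_leI le_add_diff_inverse)
  \<comment> \<open>The exponents differ by
    \<open>(k - j) * (k + j + 1) = (k - j) * N\<close>.\<close>
  have "q ^ (k\<^sup>2 + k) = q ^ (j\<^sup>2 + j)"
  proof (rule q_pow_eqI)
    have "k = j + d" using k d by simp
    then show "k\<^sup>2 + k = j\<^sup>2 + j + N * d"
      unfolding d by (simp add: power2_eq_square algebra_simps)
  qed
  then show ?thesis
    using bailey_step_aux[OF j, of l] unfolding i by (simp only: mult_ac)
qed

section \<open>The multisum\<close>

text \<open>The outer factor is left as a parameter \<open>w\<close>, so that summing out the
  largest entry gives a sum of the same shape with one level fewer.\<close>

definition bounded_sum :: "nat \<Rightarrow> (nat \<Rightarrow> complex) \<Rightarrow> complex" where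
  "bounded_sum p w = (\<Sum>n | n \<in> H6_index p \<and> n p < N.
     w (n p) * (\<Prod>i=1..p-1. q ^ ((n i)\<^sup>2 + n i) * qbinom q (n (i + 1)) (n i)))"

lemma H6_index_le:
  assumes "n \<in> H6_index p" "i \<in> {1..p}"
  shows "n i \<le> n p"
proof -
  from assms(2) have "i \<le> p" "1 \<le> i" by auto
  then show ?thesis
  proof (induction rule: inc_induct)
    case (step k)
    then have "n k \<le> n (k + 1)" using assms(1) by (auto simp: H6_index_def)
    with step show ?case by simp
  qed simp
qed

lemma finite_bounded_index: "finite {n \<in> H6_index p. n p < N}"
proof (rule finite_subset)
  show "{n \<in> H6_index p. n p < N} \<subseteq> {1..p} \<rightarrow>\<^sub>E {..<N}"
  proof
    fix n assume n: "n \<in> {n \<in> H6_index p. n p < N}"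
    have "n i < N" if "i \<in> {1..p}" for i
      using H6_index_le[OF _ that, of n] n by auto
    then show "n \<in> {1..p} \<rightarrow>\<^sub>E {..<N}"
      using n by (force simp: H6_index_def PiE_def Pi_def)
  qed
qed (auto intro: finite_PiE)

lemma H6_eq_bounded_sum: "H6 p q = bounded_sum p (\<lambda>n. q powi (- (int n)\<^sup>2) * qpoch (q ^ (n + 1)) q n)"
proof -
  have "H6 p q = infsum (H6_term p q) {n \<in> H6_index p. n p < N}"
    unfolding H6_def
  proof (rule infsum_cong_neutral)
    fix n assume "n \<in> H6_index p - {n \<in> H6_index p. n p < N}"
    then have "n p \<ge> N" by auto
    then show "H6_term p q n = 0"
      unfolding H6_term_def qpoch_shift_eq_0[OF prim \<open>n p \<ge> N\<close>] by simp
  qed auto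
  also have "\<dots> = sum (H6_term p q) {n \<in> H6_index p. n p < N}"
    by (rule infsum_finite) (rule finite_bounded_index)
  finally show ?thesis by (simp add: bounded_sum_def H6_term_def)
qed

lemma bounded_sum_1: "bounded_sum 1 w = (\<Sum>x<N. w x)"
  unfolding bounded_sum_def
proof (rule sum.reindex_bij_witness[of _ "\<lambda>x. \<lambda>i\<in>{1}. x" "\<lambda>n. n 1"], goal_cases)
  case (1 n)
  then have "n \<in> extensional {1}" by (simp add: H6_index_def PiE_def)
  then show ?case by (intro extensionalityI[of _ "{1}"]) auto
next
  case (4 x)
  then show ?case by (simp add: H6_index_def)
qed auto

lemma bounded_sum_Suc:
  assumes "p \<ge> 1"
  shows "bounded_sum (Suc p) w
    = bounded_sum p (\<lambda>l. q ^ (l\<^sup>2 + l) * (\<Sum>x=l..<N. w x * qbinom q x l))"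
proof -
  let ?B = "\<lambda>p. {n. n \<in> H6_index p \<and> n p < N}"
  define G where "G p n = (\<Prod>i=1..p. q ^ ((n i)\<^sup>2 + n i) * qbinom q (n (i + 1)) (n i))"
    for p :: nat and n :: "nat \<Rightarrow> nat"
  have G_Suc: "G p n = G (p - 1) n * (q ^ ((n p)\<^sup>2 + n p) * qbinom q (n (Suc p)) (n p))" for n
    using assms by (cases p) (simp_all add: G_def)
  have G_cong: "G (p - 1) (n(Suc p := x)) = G (p - 1) n" for n x
    unfolding G_def by (rule prod.cong) auto
  have "bounded_sum (Suc p) w = (\<Sum>n\<in>?B (Suc p). w (n (Suc p)) * G p n)"
    by (simp add: bounded_sum_def G_def)
  also have "\<dots> = (\<Sum>(n, x)\<in>Sigma (?B p) (\<lambda>n. {n p..<N}). w x * G p (n(Suc p := x)))"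
  \<comment> \<open>A tuple is split into its last entry and its truncation; the value
    \<open>undefined\<close> at \<open>Suc p\<close> makes the truncation extensional on
    \<open>{1..p}\<close>.\<close>
  proof (rule sum.reindex_bij_witness[of _ "\<lambda>(n, x). n(Suc p := x)"
        "\<lambda>n. (n(Suc p := undefined), n (Suc p))"], goal_cases)
    case (1 n)
    then show ?case by simp
  next
    case (2 n)
    have "n p \<le> n (Suc p)" using 2 assms by (auto simp: H6_index_def)
    moreover have "n(Suc p := undefined) \<in> H6_index p"
      using 2 by (auto simp: H6_index_def PiE_def extensional_def)
    ultimately show ?case using 2 by simp
  next
    case (3 b)
    obtain n x where b: "b = (n, x)" by (cases b)
    have "n (Suc p) = undefined"
      using 3 b by (auto simp: H6_index_def PiE_def extensional_def)
    then show ?case by (simp add: b fun_upd_idem)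
  next
    case (4 b)
    obtain n x where b: "b = (n, x)" by (cases b)
    have "n(Suc p := x) \<in> H6_index (Suc p)"
      using 4 b by (auto simp: H6_index_def PiE_def extensional_def less_Suc_eq)
    then show ?case using 4 b by simp
  next
    case (5 n)
    then show ?case by simp
  qed
  also have "\<dots> = (\<Sum>n\<in>?B p. \<Sum>x=n p..<N. w x * G p (n(Suc p := x)))"
    using finite_bounded_index by (intro sum.Sigma [symmetric]) auto
  also have "\<dots> = (\<Sum>n\<in>?B p. (q ^ ((n p)\<^sup>2 + n p) * (\<Sum>x=n p..<N. w x * qbinom q x (n p)))
      * G (p - 1) n)"
    unfolding G_Suc G_cong by (intro sum.cong) (simp_all add: sum_distrib_left sum_distrib_right mult_ac)
  finally show ?thesis by (simp add: bounded_sum_def G_def)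
qed

section \<open>Iterating on combinations of eigenvectors\<close>

text \<open>The combination of the eigenvectors \<open>v_k\<close> with coefficients
  \<open>A k\<close>, scaled by \<open>(q)_(N-1)\<close>. The factor \<open>1/(q)_n\<close>
  compensates for the numerator \<open>(q)_n\<close> of \<open>qbinom\<close>, which the matrix of
  the outline omits.\<close>

definition bailey_weight :: "(nat \<Rightarrow> complex) \<Rightarrow> nat \<Rightarrow> complex" where
  "bailey_weight A n = q ^ (n\<^sup>2 + n) * rqpoch q (int n) * qpoch q q (N - 1)
     * (\<Sum>k<N. A k * (rqpoch q (int k - int n) * rqpoch q (int N - 1 - int k - int n)))"

lemma sum_bailey_weight_rqpoch:
  "(\<Sum>n<N. bailey_weight A n * qpoch q q n * rqpoch q (int n - int l))
    = qpoch q q (N - 1) * (\<Sum>k<N. A k * q ^ (k\<^sup>2 + k)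
        * (rqpoch q (int k - int l) * rqpoch q (int N - 1 - int k - int l)))"
proof -
  let ?R = "\<lambda>k n. rqpoch q (int k - int n) * rqpoch q (int N - 1 - int k - int n)"
  let ?C = "qpoch q q (N - 1)"
  have "(\<Sum>n<N. bailey_weight A n * qpoch q q n * rqpoch q (int n - int l))
      = (\<Sum>n<N. \<Sum>k<N. ?C * (A k * (q ^ (n\<^sup>2 + n) * ?R k n * rqpoch q (int n - int l))))"
  proof (rule sum.cong)
    fix n assume "n \<in> {..<N}"
    then have one: "rqpoch q (int n) * qpoch q q n = 1"
      using qpoch_nonzero[of n] by (simp add: rqpoch_of_nat)
    have "bailey_weight A n * qpoch q q n * rqpoch q (int n - int l)
        = (rqpoch q (int n) * qpoch q q n)
          * (?C * (q ^ (n\<^sup>2 + n) * (\<Sum>k<N. A k * ?R k n) * rqpoch q (int n - int l)))"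
      unfolding bailey_weight_def by (simp only: mult_ac)
    also have "\<dots> = (\<Sum>k<N. ?C * (A k * (q ^ (n\<^sup>2 + n) * ?R k n * rqpoch q (int n - int l))))"
      unfolding one mult_1 sum_distrib_left sum_distrib_right by (simp only: mult_ac)
    finally show "bailey_weight A n * qpoch q q n * rqpoch q (int n - int l)
        = (\<Sum>k<N. ?C * (A k * (q ^ (n\<^sup>2 + n) * ?R k n * rqpoch q (int n - int l))))" .
  qed simp
  also have "\<dots> = (\<Sum>k<N. ?C * (A k
      * (\<Sum>n<N. q ^ (n\<^sup>2 + n) * ?R k n * rqpoch q (int n - int l))))"
    by (subst sum.swap) (simp only: sum_distrib_left)
  also have "\<dots> = (\<Sum>k<N. ?C * (A k * (q ^ (k\<^sup>2 + k) * ?R k l)))"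
    using bailey_step by (intro sum.cong) auto
  finally show ?thesis by (simp add: sum_distrib_left mult.assoc)
qed

text \<open>One summation of the multisum acts on the coefficients by the eigenvalues alone.\<close>

lemma bailey_weight_step:
  assumes "l < N"
  shows "q ^ (l\<^sup>2 + l) * (\<Sum>x=l..<N. bailey_weight A x * qbinom q x l)
    = bailey_weight (\<lambda>k. A k * q ^ (k\<^sup>2 + k)) l"
proof -
  have "(\<Sum>x=l..<N. bailey_weight A x * qbinom q x l)
      = (\<Sum>x=l..<N. rqpoch q (int l) * (bailey_weight A x * qpoch q q x * rqpoch q (int x - int l)))"
  proof (rule sum.cong)
    fix x assume "x \<in> {l..<N}"
    then have "int x - int l = int (x - l)" by auto
    then show "bailey_weight A x * qbinom q x l
        = rqpoch q (int l) * (bailey_weight A x * qpoch q q x * rqpoch q (int x - int l))"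
      by (simp only: rqpoch_of_nat qbinom_def) simp
  qed simp
  also have "\<dots> = (\<Sum>x<N. rqpoch q (int l)
      * (bailey_weight A x * qpoch q q x * rqpoch q (int x - int l)))"
    by (intro sum.mono_neutral_left) auto
  finally show ?thesis
    unfolding sum_distrib_left [symmetric] sum_bailey_weight_rqpoch
    by (simp add: bailey_weight_def mult_ac)
qed

text \<open>This is the matrix step at \<open>l = 0\<close>. The eigenvalue exponent
  \<open>k^2 + k\<close> is twice a triangular number; \<open>qpoch_reflect\<close> absorbs one
  half, leaving the sign.\<close>

lemma sum_bailey_weight:
  "(\<Sum>n<N. bailey_weight A n) = (\<Sum>k<N. (-1) ^ k * q ^ ((k + 1) choose 2) * A k)"
proof -
  have "(\<Sum>n<N. bailey_weight A n)
      = (\<Sum>n<N. bailey_weight A n * qpoch q q n * rqpoch q (int n - int 0))"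
    by (rule sum.cong) (use qpoch_nonzero in \<open>auto simp: rqpoch_of_nat\<close>)
  also have "\<dots> = (\<Sum>k<N. qpoch q q (N - 1) * (A k * q ^ (k\<^sup>2 + k)
        * (rqpoch q (int k) * rqpoch q (int N - 1 - int k))))"
    unfolding sum_bailey_weight_rqpoch by (simp add: sum_distrib_left)
  also have "\<dots> = (\<Sum>k<N. (-1) ^ k * q ^ ((k + 1) choose 2) * A k)"
  proof (rule sum.cong)
    fix k assume "k \<in> {..<N}"
    then have k: "k < N" by simp
    have i: "int N - 1 - int k = int (N - 1 - k)" using k by auto
    have "k\<^sup>2 + k = ((k + 1) choose 2) + ((k + 1) choose 2)"
    proof -
      have "2 * ((k + 1) choose 2) = (k + 1) * k"
        unfolding choose_two using dvd_mult_div_cancel[of 2 "(k + 1) * k"] by simp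
      then show ?thesis by (simp add: power2_eq_square algebra_simps)
    qed
    then have e: "q ^ (k\<^sup>2 + k) = q ^ ((k + 1) choose 2) * q ^ (Suc k choose 2)"
      by (simp flip: power_add)
    have "qpoch q q (N - 1) * (A k * q ^ (k\<^sup>2 + k)
        * (rqpoch q (int k) * rqpoch q (int N - 1 - int k)))
      = q ^ (Suc k choose 2) * qpoch q q (N - 1) * (rqpoch q (int k) * rqpoch q (int (N - 1 - k)))
        * (q ^ ((k + 1) choose 2) * A k)"
      unfolding i e by (simp only: mult_ac)
    also have "q ^ (Suc k choose 2) * qpoch q q (N - 1)
        * (rqpoch q (int k) * rqpoch q (int (N - 1 - k))) = (-1) ^ k"
      unfolding qpoch_reflect[OF k, symmetric] rqpoch_of_nat
      using qpoch_nonzero[of k] qpoch_nonzero[of "N - 1 - k"] k by simp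
    finally show "qpoch q q (N - 1) * (A k * q ^ (k\<^sup>2 + k)
        * (rqpoch q (int k) * rqpoch q (int N - 1 - int k)))
      = (-1) ^ k * q ^ ((k + 1) choose 2) * A k"
      by (simp only: mult.assoc)
  qed simp
  finally show ?thesis .
qed

lemma bounded_sum_bailey_weight:
  "bounded_sum (Suc p) (bailey_weight A)
    = (\<Sum>k<N. (-1) ^ k * q ^ ((k + 1) choose 2) * (A k * (q ^ (k\<^sup>2 + k)) ^ p))"
proof (induction p arbitrary: A)
  case 0
  then show ?case using bounded_sum_1 sum_bailey_weight by simp
next
  case (Suc p)
  have "bounded_sum (Suc (Suc p)) (bailey_weight A)
      = bounded_sum (Suc p) (\<lambda>l. q ^ (l\<^sup>2 + l) * (\<Sum>x=l..<N. bailey_weight A x * qbinom q x l))"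
    by (rule bounded_sum_Suc) simp
  also have "\<dots> = bounded_sum (Suc p) (bailey_weight (\<lambda>k. A k * q ^ (k\<^sup>2 + k)))"
    unfolding bounded_sum_def using bailey_weight_step by (intro sum.cong) auto
  finally show ?case unfolding Suc.IH by (simp add: mult_ac)
qed

text \<open>This puts the outer factor of \<open>H6\<close> in eigenvector form, by
  \<open>sum_alpha6_rqpoch\<close> and the reflection of \<open>(q)_(2n)\<close>, whose even length
  removes the sign.\<close>

lemma bailey_weight_alpha6:
  assumes "n < N"
  shows "bailey_weight (alpha6 q) n = q powi (- (int n)\<^sup>2) * qpoch (q ^ (n + 1)) q n"
proof -
  have P: "qpoch q q (2 * n) = qpoch q q n * qpoch (q ^ (n + 1)) q n"
    using qpoch_add[of q q n n] by (simp add: mult_2)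
  have nz: "qpoch q q n \<noteq> 0" by (rule qpoch_nonzero[OF assms])
  show ?thesis
  proof (cases "2 * n < N")
    case False
    \<comment> \<open>The two arguments add up to \<open>N - 1 - 2 * n < 0\<close>, so one of them
      is negative.\<close>
    have z: "rqpoch q (int k - int n) * rqpoch q (int N - 1 - int k - int n) = 0" for k
      using False by (cases "n \<le> k") auto
    have z': "qpoch (q ^ (n + 1)) q n = 0"
      using P qpoch_zero[of "2 * n"] nz False by simp
    show ?thesis unfolding bailey_weight_def z z' by simp
  next
    case True
    \<comment> \<open>The part \<open>n^2 + n\<close> matches the power in
      \<open>bailey_weight\<close>; the remaining \<open>n^2\<close> yields
      \<open>q^(-n^2)\<close>.\<close>
    have "Suc (2 * n) choose 2 = n\<^sup>2 + n + n\<^sup>2"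
      by (simp add: choose_two power2_eq_square algebra_simps)
    then have r: "qpoch q q (N - 1 - 2 * n) * qpoch q q (2 * n)
        = q ^ (n\<^sup>2 + n) * q ^ n\<^sup>2 * qpoch q q (N - 1)"
      using qpoch_reflect[OF True] by (simp add: power_add)
    have "bailey_weight (alpha6 q) n
        = q ^ (n\<^sup>2 + n) * qpoch q q (N - 1) / (qpoch q q (N - 1 - 2 * n) * qpoch q q n)"
      unfolding bailey_weight_def sum_alpha6_rqpoch[OF True] by (simp add: rqpoch_of_nat)
    also have "\<dots> = qpoch q q (2 * n) / q ^ n\<^sup>2 / qpoch q q n"
      using r q_nonzero nz qpoch_nonzero[of "N - 1 - 2 * n"] N_pos by (simp add: field_simps)
    also have "\<dots> = qpoch (q ^ (n + 1)) q n / q ^ n\<^sup>2"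
      unfolding P using nz by simp
    also have "\<dots> = q powi (- (int n)\<^sup>2) * qpoch (q ^ (n + 1)) q n"
    proof -
      have "q powi (- int (n\<^sup>2)) = 1 / q ^ n\<^sup>2"
        unfolding power_int_minus power_int_of_nat by (simp add: divide_inverse)
      then show ?thesis by simp
    qed
    finally show ?thesis .
  qed
qed

end

theorem theorem2p7:
  fixes p N :: nat and q :: complex
  assumes "p \<ge> 1" and "N \<ge> 1" and "primitive_unity_root N q"
  shows "H6 p q =
    (\<Sum>k=0..N-1. (-1) ^ k * q ^ (((k + 1) choose 2) + (p - 1) * (k\<^sup>2 + k)) * alpha6 q k)"
proof -
  note prim = assms(3)
  obtain r where p: "p = Suc r" using assms(1) by (cases p) auto
  have "H6 p q = bounded_sum N q (Suc r) (bailey_weight N q (alpha6 q))"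
    unfolding H6_eq_bounded_sum[OF prim] bounded_sum_def[OF prim] p
    using bailey_weight_alpha6[OF prim] by (intro sum.cong) auto
  also have "\<dots> = (\<Sum>k<N. (-1) ^ k * q ^ ((k + 1) choose 2) * (alpha6 q k * (q ^ (k\<^sup>2 + k)) ^ r))"
    by (rule bounded_sum_bailey_weight[OF prim])
  also have "{..<N} = {0..N-1}" using assms(2) by auto
  also have "(\<Sum>k\<in>{0..N-1}. (-1) ^ k * q ^ ((k + 1) choose 2) * (alpha6 q k * (q ^ (k\<^sup>2 + k)) ^ r))
      = (\<Sum>k=0..N-1. (-1) ^ k * q ^ (((k + 1) choose 2) + (p - 1) * (k\<^sup>2 + k)) * alpha6 q k)"
  proof (rule sum.cong)
    fix k
    have "(q ^ (k\<^sup>2 + k)) ^ r = q ^ ((p - 1) * (k\<^sup>2 + k))"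
      by (simp only: p diff_Suc_1 power_mult [symmetric] mult.commute)
    then show "(-1) ^ k * q ^ ((k + 1) choose 2) * (alpha6 q k * (q ^ (k\<^sup>2 + k)) ^ r)
        = (-1) ^ k * q ^ (((k + 1) choose 2) + (p - 1) * (k\<^sup>2 + k)) * alpha6 q k"
      by (simp only: power_add mult_ac)
  qed simp
  finally show ?thesis .
qed

end
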